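(* Let $u^A,u^B>0$, $q>0$, $p\ge 0$ and $\alpha\in[0,1]$, and consider the two-player all-pay auction with favoritism with these parameters. Distributions on $[0,\infty)$ are given by their cumulative distribution functions. (i) If $q u^B-p\le 0$, there exists a unique pure equilibrium; in it the bids are $x^A=x^B=0$ and the equilibrium payoffs are $\Pi^A=u^A$ and $\Pi^B=0$. (ii) If $0<q u^B-p\le u^A$, there exists no pure equilibrium, and there is a unique mixed equilibrium, in which Player A draws her bid from the distribution $F_{A_2^+}$ and Player B draws her bid from the distribution $F_{B_2^+}$, where $$F_{A_2^+}(x)=\begin{cases}\frac{p}{q u^B}+\frac{x}{q u^B}, & x\in[0,q u^B-p],\\ 1,& x>q u^B-p,\end{cases}\qquad F_{B_2^+}(x)=\begin{cases}1-\frac{q u^B}{u^A}+\frac{p}{u^A}, & x\in[0,\frac pq),\\ 1-\frac{q u^B}{u^A}+\frac{q x}{u^A}, & x\in[\frac pq,u^B],\\ 1,& x>u^B.\end{cases}$$ In this mixed equilibrium the payoffs are $\Pi^A=u^A-q u^B+p$ and $\Pi^B=0$. (iii) If $q u^B-p>u^A$, there exists no pure equilibrium, and there is a unique mixed equilibrium, in which Player A draws her bid from the distribution $F_{A_3^+}$ and Player B draws her bid from the distribution $F_{B_3^+}$, where $$F_{A_3^+}(x)=\begin{cases}1-\frac{u^A}{q u^B}+\frac{x}{q u^B}, & x\in[0,u^A],\\ 1,& x>u^A,\end{cases}\qquad F_{B_3^+}(x)=\begin{cases}0, & x\in[0,\frac pq),\\ -\frac{p}{u^A}+\frac{q x}{u^A},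 & x\in[\frac pq,\frac{u^A+p}{q}],\\ 1,& x>\frac{u^A+p}{q}.\end{cases}$$ In this mixed equilibrium the payoffs are $\Pi^A=0$ and $\Pi^B=u^B-(u^A+p)/q$.
   Context: All-pay auction with favoritism: a two-player simultaneous-move complete-information game with parameters $u^A,u^B>0$ (values of the item to Players A and B), $p\in\mathbb{R}$, $q>0$, $\alpha\in[0,1]$. Each player chooses a bid in $[0,\infty)$. Define $\beta(x,y)=1$ if $x>y$, $\beta(x,y)=\alpha$ if $x=y$, $\beta(x,y)=0$ if $x<y$. When the bids are $x^A,x^B\ge 0$ the payoffs are $$\Pi^A(x^A,x^B)=u^A\,\beta(x^A,qx^B-p)-x^A,\qquad \Pi^B(x^A,x^B)=u^B\,[1-\beta(x^A,qx^B-p)]-x^B.$$ A mixed strategy is a probability distribution on $[0,\infty)$; the players randomize independently and payoffs of mixed strategies are expected payoffs. "Equilibrium" means Nash equilibrium; a pure equilibrium is one in which both players use pure strategies (deterministic bids). *)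

theory Defs
  imports "HOL-Probability.Probability"
begin

definition win_share :: "real \<Rightarrow> real \<Rightarrow> real \<Rightarrow> real" where
  "win_share \<alpha> x y = (if x > y then 1 else if x = y then \<alpha> else 0)"

definition payoffA :: "real \<Rightarrow> real \<Rightarrow> real \<Rightarrow> real \<Rightarrow> real \<Rightarrow> real \<Rightarrow> real" where
  "payoffA uA p q \<alpha> xA xB = uA * win_share \<alpha> xA (q * xB - p) - xA"

definition payoffB :: "real \<Rightarrow> real \<Rightarrow> real \<Rightarrow> real \<Rightarrow> real \<Rightarrow> real \<Rightarrow> real" where
  "payoffB uB p q \<alpha> xA xB = uB * (1 - win_share \<alpha> xA (q * xB - p)) - xB"

text \<open>Mixed strategies are Borel probability measures on the real line concentrated on
  \<open>[0, \<infinity>)\<close>, so that the library's \<^const>\<open>cdf\<close> applies to them.\<close>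

definition mixed_strategy :: "real measure \<Rightarrow> bool" where
  "mixed_strategy M \<longleftrightarrow> real_distribution M \<and> measure M {0..} = 1"

definition pure_strategy :: "real \<Rightarrow> real measure" where
  "pure_strategy x = return borel x"

text \<open>Mixed strategies may have infinite mean. The Bochner integral of a payoff would then be
  the junk value 0, whereas the expected payoff is \<open>-\<infinity>\<close>. Hence the expectation is taken in the
  extended reals, as the integral of the positive part minus the integral of the negative part
  (\<^const>\<open>ennreal\<close> maps negative reals to 0). The positive part of each payoff is bounded on the
  bids in \<open>[0, \<infinity>)\<close>, so the difference is never \<open>\<infinity> - \<infinity>\<close>.\<close>

definition expected_payoff ::
    "(real \<Rightarrow> real \<Rightarrow> real) \<Rightarrow> real measure \<Rightarrow> real measure \<Rightarrow> ereal" where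
  "expected_payoff f M N =
     enn2ereal (\<integral>\<^sup>+ z. ennreal (f (fst z) (snd z)) \<partial>(M \<Otimes>\<^sub>M N))
     - enn2ereal (\<integral>\<^sup>+ z. ennreal (- f (fst z) (snd z)) \<partial>(M \<Otimes>\<^sub>M N))"

definition nash_equilibrium ::
    "(real \<Rightarrow> real \<Rightarrow> real) \<Rightarrow> (real \<Rightarrow> real \<Rightarrow> real) \<Rightarrow> real measure \<Rightarrow> real measure \<Rightarrow> bool" where
  "nash_equilibrium fA fB M N \<longleftrightarrow>
     mixed_strategy M \<and> mixed_strategy N \<and>
     (\<forall>M'. mixed_strategy M' \<longrightarrow> expected_payoff fA M' N \<le> expected_payoff fA M N) \<and>
     (\<forall>N'. mixed_strategy N' \<longrightarrow> expected_payoff fB M N' \<le> expected_payoff fB M N)"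

definition auction_equilibrium ::
    "real \<Rightarrow> real \<Rightarrow> real \<Rightarrow> real \<Rightarrow> real \<Rightarrow> real measure \<Rightarrow> real measure \<Rightarrow> bool" where
  "auction_equilibrium uA uB p q \<alpha> = nash_equilibrium (payoffA uA p q \<alpha>) (payoffB uB p q \<alpha>)"

definition pure_auction_equilibrium ::
    "real \<Rightarrow> real \<Rightarrow> real \<Rightarrow> real \<Rightarrow> real \<Rightarrow> real \<Rightarrow> real \<Rightarrow> bool" where
  "pure_auction_equilibrium uA uB p q \<alpha> xA xB \<longleftrightarrow>
     auction_equilibrium uA uB p q \<alpha> (pure_strategy xA) (pure_strategy xB)"

text \<open>The distribution functions are given on \<open>[0, \<infinity>)\<close> in the source; as functions on the whole
  real line they vanish on the negative numbers.\<close>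

definition F_A2 :: "real \<Rightarrow> real \<Rightarrow> real \<Rightarrow> real \<Rightarrow> real" where
  "F_A2 uB p q x =
     (if x < 0 then 0
      else if x \<le> q * uB - p then p / (q * uB) + x / (q * uB)
      else 1)"

definition F_B2 :: "real \<Rightarrow> real \<Rightarrow> real \<Rightarrow> real \<Rightarrow> real \<Rightarrow> real" where
  "F_B2 uA uB p q x =
     (if x < 0 then 0
      else if x < p / q then 1 - q * uB / uA + p / uA
      else if x \<le> uB then 1 - q * uB / uA + q * x / uA
      else 1)"

definition F_A3 :: "real \<Rightarrow> real \<Rightarrow> real \<Rightarrow> real \<Rightarrow> real" where
  "F_A3 uA uB q x =
     (if x < 0 then 0
      else if x \<le> uA then 1 - uA / (q * uB) + x / (q * uB)
      else 1)"

definition F_B3 :: "real \<Rightarrow> real \<Rightarrow> real \<Rightarrow> real \<Rightarrow> real" where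
  "F_B3 uA p q x =
     (if x < 0 then 0
      else if x < p / q then 0
      else if x \<le> (uA + p) / q then - (p / uA) + q * x / uA
      else 1)"

lemma mixed_strategy_pure: "mixed_strategy (pure_strategy x) \<longleftrightarrow> 0 \<le> x"
  unfolding mixed_strategy_def pure_strategy_def real_distribution_def
    real_distribution_axioms_def
  by (simp add: prob_space_return measure_return indicator_def)

lemma win_share_measurable [measurable]:
  "(\<lambda>z. win_share \<alpha> (fst z) (q * snd z - p)) \<in> borel_measurable (borel \<Otimes>\<^sub>M borel)"
  unfolding win_share_def by measurable

lemma payoffA_measurable [measurable]:
  "(\<lambda>z. payoffA uA p q \<alpha> (fst z) (snd z)) \<in> borel_measurable (borel \<Otimes>\<^sub>M borel)"
  unfolding payoffA_def by measurable

lemma payoffB_measurable [measurable]: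
  "(\<lambda>z. payoffB uB p q \<alpha> (fst z) (snd z)) \<in> borel_measurable (borel \<Otimes>\<^sub>M borel)"
  unfolding payoffB_def by measurable

lemma expected_payoff_pure:
  assumes m: "(\<lambda>z. f (fst z) (snd z)) \<in> borel_measurable (borel \<Otimes>\<^sub>M borel)"
  shows "expected_payoff f (pure_strategy x) (pure_strategy y) = ereal (f x y)"
proof -
  have sf: "sigma_finite_measure (return borel a)" for a :: real
    by (rule prob_space_imp_sigma_finite, rule prob_space_return) simp
  have "return borel x \<Otimes>\<^sub>M return borel y = return (borel \<Otimes>\<^sub>M borel) (x, y)"
  proof (rule pair_measure_eqI[OF sf sf])
    show "sets (return borel x \<Otimes>\<^sub>M return borel y) = sets (return (borel \<Otimes>\<^sub>M borel) (x, y))"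
      by (simp cong: sets_pair_measure_cong)
    fix A B assume "A \<in> sets (return borel x)" "B \<in> sets (return borel y)"
    then show "emeasure (return borel x) A * emeasure (return borel y) B =
        emeasure (return (borel \<Otimes>\<^sub>M borel) (x, y)) (A \<times> B)"
      by (simp add: indicator_def pair_measureI del: borel_prod)
  qed
  then have prod: "pure_strategy x \<Otimes>\<^sub>M pure_strategy y = return (borel \<Otimes>\<^sub>M borel) (x, y)"
    unfolding pure_strategy_def .
  have sp: "(x, y) \<in> space (borel \<Otimes>\<^sub>M borel)"
    by (simp add: space_pair_measure)
  have "(\<integral>\<^sup>+ z. ennreal (f (fst z) (snd z)) \<partial>return (borel \<Otimes>\<^sub>M borel) (x, y)) = ennreal (f x y)"
    using nn_integral_return[OF sp measurable_compose[OF m measurable_ennreal]] by simp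
  moreover have "(\<integral>\<^sup>+ z. ennreal (- f (fst z) (snd z)) \<partial>return (borel \<Otimes>\<^sub>M borel) (x, y)) = ennreal (- f x y)"
    using nn_integral_return[OF sp measurable_compose[OF borel_measurable_uminus[OF m] measurable_ennreal]]
    by simp
  ultimately show ?thesis
    unfolding expected_payoff_def prod
    by (cases "f x y \<ge> 0") (simp_all add: ennreal_neg zero_ennreal.rep_eq)
qed

end

theory Submission imports Defs begin

text \<open>Dividing each payoff by the player's valuation and adding the opponent's normalised bid turns the
  auction into a constant-sum game with the same best responses. Hence the strategies of any two
  equilibria are interchangeable, and every equilibrium \<open>(M, N)\<close> can be tested against one explicit
  equilibrium: \<open>M\<close> is a best response to the explicit strategy of Player B, which confines its support,
  while the explicit strategy of Player A is a best response to \<open>N\<close>, so Player A is indifferent on a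
  dense set of contested bids and the distribution function of \<open>N\<close> is affine there. Comparing both
  ends of the contested range determines the value. The same holds with the players exchanged.\<close>

section \<open>Best responses in a contest\<close>

text \<open>A bid x of Player A beats exactly the bids of Player B below (x + p) / q, so contested
  bids run over [0, L] for A and over [p / q, (L + p) / q] for B. The length L is a minimum because
  A gains nothing by bidding above \<open>uA\<close>, nor B by bidding above \<open>uB\<close>,
  which is \<open>q * uB - p\<close> on the scale of A. Indifference of A forces the density
  \<open>q / uA\<close> on B, indifference of B forces \<open>1 / (q * uB)\<close> on A, and the
  missing mass sits at 0: these are the constants of the explicit strategies. The term added to
  reach a constant sum depends on the opponent's bid alone, which is why best responses survive. The
  obstacle is ties. The chance of winning with a bid mixes the left limit and the value of a
  distribution function that may jump, and indifference is known only almost everywhere; so the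
  function is squeezed between its neighbouring values. Indifference at positive bids of A also
  leaves open, for p > 0, how the mass of B at or below p / q is divided between 0 and p / q, which
  needs a separate argument about the bid 0 of A.\<close>

lemma mixed_strategyD:
  assumes "mixed_strategy M"
  shows "real_distribution M" "prob_space M" "sets M = sets borel" "AE x in M. 0 \<le> x"
proof -
  show rd: "real_distribution M" using assms by (simp add: mixed_strategy_def)
  then interpret real_distribution M .
  show "prob_space M" by (rule prob_space_axioms)
  show "sets M = sets borel" by simp
  have "prob {0..} = 1" using assms by (simp add: mixed_strategy_def)
  then show "AE x in M. 0 \<le> x" using prob_eq_1[of "{0..}"] by simp
qed

lemma mixed_strategyI:
  assumes "prob_space M" "sets M = sets borel" "AE x in M. 0 \<le> x"
  shows "mixed_strategy M"
proof -
  interpret prob_space M by fact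
  have "{0::real..} \<in> sets M" using assms(2) by simp
  then have "prob {0..} = 1" using assms(3) prob_eq_1 by simp
  then show ?thesis using assms(1,2)
    by (simp add: mixed_strategy_def real_distribution_def real_distribution_axioms_def)
qed

text \<open>Puts Player B's own bid into the first argument, so that facts about best responses are
  proved once in \<open>contest\<close> and serve both players.\<close>

lemma expected_payoff_swap:
  assumes M: "mixed_strategy M" and N: "mixed_strategy N"
    and f: "(\<lambda>z. f (fst z) (snd z)) \<in> borel_measurable (borel \<Otimes>\<^sub>M borel)"
  shows "expected_payoff f M N = expected_payoff (\<lambda>y x. f x y) N M"
proof -
  note [measurable_cong] = mixed_strategyD(3)[OF M] mixed_strategyD(3)[OF N]
  interpret M: prob_space M by (rule mixed_strategyD(2)[OF M])
  interpret N: prob_space N by (rule mixed_strategyD(2)[OF N])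
  interpret pair_sigma_finite M N ..
  note f[measurable]
  have "(\<integral>\<^sup>+ z. ennreal (g (fst z) (snd z)) \<partial>(M \<Otimes>\<^sub>M N)) =
      (\<integral>\<^sup>+ z. ennreal (g (snd z) (fst z)) \<partial>(N \<Otimes>\<^sub>M M))"
    if [measurable]: "(\<lambda>z. g (fst z) (snd z)) \<in> borel_measurable (borel \<Otimes>\<^sub>M borel)"
    for g :: "real \<Rightarrow> real \<Rightarrow> real"
    by (subst distr_pair_swap, subst nn_integral_distr) (simp_all add: case_prod_beta')
  from this[of f] this[of "\<lambda>x y. - f x y"] show ?thesis
    unfolding expected_payoff_def by simp
qed

definition best_response :: "(real \<Rightarrow> real \<Rightarrow> real) \<Rightarrow> real measure \<Rightarrow> real measure \<Rightarrow> bool" where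
  "best_response f N M \<longleftrightarrow>
     mixed_strategy M \<and> (\<forall>M'. mixed_strategy M' \<longrightarrow> expected_payoff f M' N \<le> expected_payoff f M N)"

lemma best_responseD:
  "best_response f N M \<Longrightarrow> mixed_strategy M' \<Longrightarrow> expected_payoff f M' N \<le> expected_payoff f M N"
  by (simp add: best_response_def)

text \<open>One player's side of the auction: \<open>w x y\<close> is the chance that the own bid x
  wins against y.\<close>

locale contest =
  fixes u :: real and w :: "real \<Rightarrow> real \<Rightarrow> real"
  assumes u_pos: "0 < u"
    and w_measurable [measurable]: "(\<lambda>z. w (fst z) (snd z)) \<in> borel_measurable (borel \<Otimes>\<^sub>M borel)"
    and w_nonneg: "0 \<le> w x y" and w_le_1: "w x y \<le> 1"
begin

definition payoff :: "real \<Rightarrow> real \<Rightarrow> real" where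
  "payoff x y = u * w x y - x"

definition win_prob :: "real measure \<Rightarrow> real \<Rightarrow> real" where
  "win_prob N x = (\<integral>y. w x y \<partial>N)"

definition interim :: "real measure \<Rightarrow> real \<Rightarrow> real" where
  "interim N x = u * win_prob N x - x"

lemma payoff_measurable [measurable]:
  "(\<lambda>z. payoff (fst z) (snd z)) \<in> borel_measurable (borel \<Otimes>\<^sub>M borel)"
  unfolding payoff_def by measurable

context
  fixes M N assumes M: "mixed_strategy M" and N: "mixed_strategy N"
begin

interpretation M: prob_space M by (rule mixed_strategyD(2)[OF M])
interpretation N: prob_space N by (rule mixed_strategyD(2)[OF N])
interpretation MN: pair_prob_space M N ..

lemma meas_cong[measurable_cong]: "sets M = sets borel" "sets N = sets borel"
  by (rule mixed_strategyD(3)[OF M] mixed_strategyD(3)[OF N])+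

lemma w_integrable: "integrable N (w x)"
proof (rule N.integrable_const_bound[where B=1])
  have "(\<lambda>y. w (fst (x, y)) (snd (x, y))) \<in> borel_measurable N" by measurable
  then show "w x \<in> borel_measurable N" by simp
qed (simp add: w_nonneg w_le_1)

lemma w_pair_integrable: "integrable (M \<Otimes>\<^sub>M N) (\<lambda>z. w (fst z) (snd z))"
  by (rule MN.P.integrable_const_bound[where B=1]) (simp_all add: w_nonneg w_le_1)

lemma win_prob_integrable: "integrable M (win_prob N)"
  using MN.integrable_fst'[OF w_pair_integrable] unfolding win_prob_def by simp

lemma interim_measurable [measurable]: "interim N \<in> borel_measurable M"
proof -
  have [measurable]: "win_prob N \<in> borel_measurable M"
    using win_prob_integrable by simp
  show ?thesis unfolding interim_def by measurable
qed

lemma fst_pair_integral: "(\<integral>\<^sup>+ z. ennreal (fst z) \<partial>(M \<Otimes>\<^sub>M N)) = (\<integral>\<^sup>+ x. ennreal x \<partial>M)"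
  by (subst N.nn_integral_fst[symmetric]) (simp_all add: N.emeasure_space_1)

lemma AE_pair_nonneg: "AE z in M \<Otimes>\<^sub>M N. 0 \<le> fst z"
  by (rule MN.AE_pair_measure) (use mixed_strategyD(4)[OF M] in simp_all)

lemma expected_payoff_integrable:
  assumes "integrable M (\<lambda>x. x)"
  shows "expected_payoff payoff M N = ereal (u * (\<integral>x. win_prob N x \<partial>M) - (\<integral>x. x \<partial>M))"
    and "expected_payoff payoff M N = ereal (\<integral>x. interim N x \<partial>M)"
proof -
  have i1: "integrable (M \<Otimes>\<^sub>M N) fst"
  proof (rule integrableI_nonneg)
    show "(\<integral>\<^sup>+ z. ennreal (fst z) \<partial>(M \<Otimes>\<^sub>M N)) < \<infinity>"
      unfolding fst_pair_integral
      using integrableD(2)[OF assms] nn_integral_mono[of M ennreal "\<lambda>x. ennreal (norm x)"]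
      by (auto simp: less_top[symmetric] top_unique)
  qed (use AE_pair_nonneg in auto)
  have i: "integrable (M \<Otimes>\<^sub>M N) (\<lambda>z. payoff (fst z) (snd z))"
    unfolding payoff_def using i1 w_pair_integrable by simp
  have "integral\<^sup>L (M \<Otimes>\<^sub>M N) (\<lambda>z. payoff (fst z) (snd z)) = (\<integral>x. \<integral>y. payoff x y \<partial>N \<partial>M)"
    using MN.integral_fst'[OF i] by simp
  also have "\<dots> = (\<integral>x. interim N x \<partial>M)"
    unfolding payoff_def interim_def win_prob_def
    using w_integrable by (simp add: N.prob_space)
  finally have *: "integral\<^sup>L (M \<Otimes>\<^sub>M N) (\<lambda>z. payoff (fst z) (snd z)) = (\<integral>x. interim N x \<partial>M)" .
  have e: "enn2ereal X - enn2ereal Y = ereal (enn2real X - enn2real Y)"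
    if "X \<noteq> \<infinity>" "Y \<noteq> \<infinity>" for X Y
    using that by (cases X; cases Y) simp_all
  show 2: "expected_payoff payoff M N = ereal (\<integral>x. interim N x \<partial>M)"
    unfolding expected_payoff_def *[symmetric] real_lebesgue_integral_def[OF i]
    using i by (intro e) (auto simp: real_integrable_def)
  show "expected_payoff payoff M N = ereal (u * (\<integral>x. win_prob N x \<partial>M) - (\<integral>x. x \<partial>M))"
    unfolding 2 interim_def using win_prob_integrable assms by simp
qed

text \<open>Winning is worth at most \<open>u\<close>, so the bid is bounded by \<open>u\<close>
  plus the negative part of the payoff. An infinite mean bid therefore makes the negative part
  infinite, while the positive part stays at most \<open>u\<close>.\<close>

lemma expected_payoff_not_integrable:
  assumes "\<not> integrable M (\<lambda>x. x)"
  shows "expected_payoff payoff M N = -\<infinity>"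
proof -
  let ?P = "\<integral>\<^sup>+ z. ennreal (payoff (fst z) (snd z)) \<partial>(M \<Otimes>\<^sub>M N)"
  let ?Q = "\<integral>\<^sup>+ z. ennreal (- payoff (fst z) (snd z)) \<partial>(M \<Otimes>\<^sub>M N)"
  have inf: "(\<integral>\<^sup>+ x. ennreal x \<partial>M) = \<infinity>"
  proof (rule ccontr)
    assume "(\<integral>\<^sup>+ x. ennreal x \<partial>M) \<noteq> \<infinity>"
    then have "integrable M (\<lambda>x. x)"
      by (intro integrableI_nonneg mixed_strategyD(4)[OF M]) (simp_all add: less_top)
    with assms show False by simp
  qed
  have b: "u * w x y \<le> u" for x y
    using w_le_1[of x y] u_pos by simp
  have "(\<integral>\<^sup>+ z. ennreal (fst z) \<partial>(M \<Otimes>\<^sub>M N)) \<le>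
      (\<integral>\<^sup>+ z. ennreal u + ennreal (- payoff (fst z) (snd z)) \<partial>(M \<Otimes>\<^sub>M N))"
  proof (rule nn_integral_mono)
    fix z :: "real \<times> real"
    have "ennreal (fst z) \<le> ennreal (u + max 0 (- payoff (fst z) (snd z)))"
      using b[of "fst z" "snd z"] by (intro ennreal_leI) (simp add: payoff_def)
    also have "\<dots> = ennreal u + ennreal (- payoff (fst z) (snd z))"
      using u_pos by (subst ennreal_plus) (auto simp: max_def ennreal_neg)
    finally show "ennreal (fst z) \<le> ennreal u + ennreal (- payoff (fst z) (snd z))" .
  qed
  also have "\<dots> = ennreal u + ?Q"
    by (subst nn_integral_add) (simp_all add: MN.P.emeasure_space_1)
  finally have Q: "?Q = \<infinity>"
    unfolding fst_pair_integral inf by (auto simp: top_unique)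
  have "?P \<le> (\<integral>\<^sup>+ z. ennreal u \<partial>(M \<Otimes>\<^sub>M N))"
  proof (rule nn_integral_mono_AE, use AE_pair_nonneg in eventually_elim)
    fix z :: "real \<times> real" assume "0 \<le> fst z"
    then show "ennreal (payoff (fst z) (snd z)) \<le> ennreal u"
      using b[of "fst z" "snd z"] by (intro ennreal_leI) (simp add: payoff_def)
  qed
  then have "?P \<le> ennreal u" by (simp add: MN.P.emeasure_space_1)
  then show ?thesis unfolding expected_payoff_def Q
    by (cases ?P) (auto simp: top_unique)
qed

lemma expected_payoff_le:
  assumes "\<And>x. 0 \<le> x \<Longrightarrow> interim N x \<le> V"
  shows "expected_payoff payoff M N \<le> ereal V"
proof (cases "integrable M (\<lambda>x. x)")
  case True
  have "integrable M (interim N)"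
    unfolding interim_def using win_prob_integrable True by simp
  then have "(\<integral>x. interim N x \<partial>M) \<le> V"
    using mixed_strategyD(4)[OF M]
    by (intro M.integral_le_const) (auto elim!: eventually_mono intro: assms)
  then show ?thesis using expected_payoff_integrable(2)[OF True] by simp
qed (simp add: expected_payoff_not_integrable)

text \<open>Indifference itself yields a finite mean: almost surely the bid equals
  \<open>u * win_prob N x - V\<close>, which is bounded.\<close>

lemma expected_payoff_const:
  assumes "AE x in M. interim N x = V"
  shows "integrable M (\<lambda>x. x)" "expected_payoff payoff M N = ereal V"
proof -
  have [measurable]: "interim N \<in> borel_measurable M" by (rule interim_measurable)
  have "integrable M (\<lambda>x. u * win_prob N x - V)"
    using win_prob_integrable by simp
  then show i: "integrable M (\<lambda>x. x)"
    by (rule integrable_cong_AE_imp) (use assms in \<open>auto simp: interim_def elim!: eventually_mono\<close>)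
  have "(\<integral>x. interim N x \<partial>M) = (\<integral>x. V \<partial>M)"
    by (rule integral_cong_AE) (use assms in auto)
  then show "expected_payoff payoff M N = ereal V"
    using expected_payoff_integrable(2)[OF i] by (simp add: M.prob_space)
qed

end

lemma expected_payoff_pure_left:
  assumes x: "0 \<le> x" and N: "mixed_strategy N"
  shows "expected_payoff payoff (pure_strategy x) N = ereal (interim N x)"
proof (rule expected_payoff_const(2))
  show P: "mixed_strategy (pure_strategy x)" using x by (simp add: mixed_strategy_pure)
  show "mixed_strategy N" by fact
  show "AE y in pure_strategy x. interim N y = interim N x"
    unfolding pure_strategy_def by (rule AE_I'[of "- {x}"]) (auto simp: null_sets_def)
qed

lemma best_responseI:
  assumes M: "mixed_strategy M" and N: "mixed_strategy N"
    and "AE x in M. interim N x = V" and "\<And>x. 0 \<le> x \<Longrightarrow> interim N x \<le> V"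
  shows "best_response payoff N M"
  unfolding best_response_def
  using expected_payoff_const(2)[OF assms(1-3)] expected_payoff_le[OF _ N assms(4)] M by simp

text \<open>Deviations to pure bids bound the interim payoff by V. Its average under M is V as well,
  so the nonnegative gap has integral 0 and vanishes almost everywhere.\<close>

lemma best_responseE:
  assumes "best_response payoff N M" and N: "mixed_strategy N"
  obtains V where "mixed_strategy M" "integrable M (\<lambda>x. x)" "expected_payoff payoff M N = ereal V"
    "AE x in M. interim N x = V" "\<And>x. 0 \<le> x \<Longrightarrow> interim N x \<le> V"
proof -
  have M: "mixed_strategy M"
    and le: "\<And>M'. mixed_strategy M' \<Longrightarrow> expected_payoff payoff M' N \<le> expected_payoff payoff M N"
    using assms(1) by (auto simp: best_response_def)
  interpret M: prob_space M by (rule mixed_strategyD(2)[OF M])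
  have pure: "ereal (interim N x) \<le> expected_payoff payoff M N" if "0 \<le> x" for x
    using le[of "pure_strategy x"] expected_payoff_pure_left[OF that N] that
    by (simp add: mixed_strategy_pure)
  \<comment> \<open>The bid 0 earns a finite payoff, which an optimal strategy cannot undercut with
    minus infinity.\<close>
  have i: "integrable M (\<lambda>x. x)"
    using pure[of 0] expected_payoff_not_integrable[OF M N] by (cases "integrable M (\<lambda>x. x)") simp_all
  define V where "V = (\<integral>x. interim N x \<partial>M)"
  have V: "expected_payoff payoff M N = ereal V"
    using expected_payoff_integrable(2)[OF M N i] by (simp add: V_def)
  have up: "interim N x \<le> V" if "0 \<le> x" for x using pure[OF that] V by simp
  have int: "integrable M (interim N)"
    unfolding interim_def using win_prob_integrable[OF M N] i by simp
  have "AE x in M. V - interim N x = 0"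
  proof (subst integral_nonneg_eq_0_iff_AE[symmetric])
    show "AE x in M. 0 \<le> V - interim N x"
      using mixed_strategyD(4)[OF M] by eventually_elim (simp add: up)
    show "(\<integral>x. V - interim N x \<partial>M) = 0"
      using int by (simp add: V_def M.prob_space)
  qed (use int in simp)
  then have "AE x in M. interim N x = V" by eventually_elim simp
  with that M i V up show ?thesis by blast
qed

end

section \<open>Distribution functions and winning probabilities\<close>

text \<open>The chance of winning with a bid that beats everything below s and wins a tie at s with
  weight \<open>\<gamma>\<close>. Weight 1 gives \<open>cdf\<close>; Player A has weight
  \<open>\<alpha>\<close>, Player B \<open>1 - \<alpha>\<close>.\<close>

definition share :: "real \<Rightarrow> real measure \<Rightarrow> real \<Rightarrow> real" where
  "share \<gamma> N s = measure N {..<s} + \<gamma> * measure N {s}"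

lemma cdf_eq_share:
  assumes "real_distribution N"
  shows "cdf N s = share 1 N s"
proof -
  interpret real_distribution N by fact
  have "{..s} = {..<s} \<union> {s}" by auto
  show ?thesis unfolding cdf_def share_def \<open>{..s} = {..<s} \<union> {s}\<close>
    by (subst finite_measure_Union) auto
qed

lemma share_mono:
  assumes "\<gamma> \<le> \<delta>"
  shows "share \<gamma> N s \<le> share \<delta> N s"
  unfolding share_def using assms by (simp add: mult_right_mono)

lemma share_le_1:
  assumes "real_distribution N" "\<gamma> \<le> 1"
  shows "share \<gamma> N s \<le> 1"
proof -
  interpret real_distribution N by fact
  show ?thesis
    using share_mono[OF assms(2), of N s] cdf_bounded_prob[of s] cdf_eq_share[OF assms(1)] by simp
qed

lemma cdf_le_share:
  assumes "real_distribution N" "0 \<le> \<gamma>" "s < t"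
  shows "cdf N s \<le> share \<gamma> N t"
proof -
  interpret real_distribution N by fact
  have "cdf N s \<le> measure N {..<t}"
    unfolding cdf_def using assms(3) by (intro finite_measure_mono) auto
  then show ?thesis unfolding share_def using assms(2) by (simp add: add_increasing2)
qed

text \<open>Whatever the tie weight, \<open>share\<close> lies between the values of
  \<open>cdf\<close> to the left of t and the value at t. Points where it equals g therefore bound
  \<open>cdf\<close> above from the right and below from the left, and continuity of g closes the
  gap.\<close>

lemma cdf_eq_of_share_dense:
  assumes N: "real_distribution N" and \<gamma>: "0 \<le> \<gamma>" "\<gamma> \<le> 1"
    and dense: "\<And>c d. l \<le> c \<Longrightarrow> c < d \<Longrightarrow> d \<le> r \<Longrightarrow> \<exists>t. c < t \<and> t < d \<and> share \<gamma> N t = g t"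
    and g: "continuous_on UNIV g" and s: "l \<le> s" "s < r"
  shows "cdf N s = g s"
proof -
  interpret real_distribution N by fact
  have g': "(g \<longlongrightarrow> g t) (at t within S)" for t S
    using g by (auto simp: continuous_on_def intro: tendsto_within_subset)
  have up: "cdf N t \<le> g t" if t: "l \<le> t" "t < r" for t
  proof (rule ccontr)
    assume "\<not> cdf N t \<le> g t"
    then have "eventually (\<lambda>x. g x < cdf N t) (at_right t)"
      by (intro order_tendstoD(2)[OF g']) simp
    then obtain b where b: "b > t" "\<And>y. t < y \<Longrightarrow> y < b \<Longrightarrow> g y < cdf N t"
      unfolding eventually_at_right_field by blast
    obtain y where "t < y" "y < min b r" "share \<gamma> N y = g y"
      using dense[of t "min b r"] b(1) t by auto
    then show False using b(2)[of y] cdf_le_share[OF N \<gamma>(1), of t y] by simp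
  qed
  have low: "g t \<le> cdf N t" if t: "l < t" "t < r" for t
  proof (rule ccontr)
    assume "\<not> g t \<le> cdf N t"
    then have "eventually (\<lambda>x. cdf N t < g x) (at_left t)"
      by (intro order_tendstoD(1)[OF g']) simp
    then obtain b where b: "b < t" "\<And>y. b < y \<Longrightarrow> y < t \<Longrightarrow> cdf N t < g y"
      unfolding eventually_at_left_field by blast
    obtain y where y: "max b l < y" "y < t" "share \<gamma> N y = g y"
      using dense[of "max b l" t] b(1) t by auto
    have "g y \<le> cdf N y" using share_mono[OF \<gamma>(2), of N y] y(3) cdf_eq_share[OF N] by simp
    also have "\<dots> \<le> cdf N t" using y by (intro cdf_nondecreasing) simp
    finally show False using b(2)[of y] y by simp
  qed
  \<comment> \<open>The lower bound uses points on the left and so fails to reach s = l directly;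
    right continuity carries it there.\<close>
  have "eventually (\<lambda>t. g t \<le> cdf N t) (at_right s)"
    unfolding eventually_at_right_field using s low by (intro exI[of _ r]) auto
  then have "g s \<le> cdf N s"
    using cdf_is_right_cont[of s]
    by (intro tendsto_le[OF _ _ g'[of s]]) (auto simp: continuous_within)
  with up[OF s] show ?thesis by simp
qed

lemma AE_lborel_dense:
  assumes "AE t in lborel. P t" "c < (d::real)"
  obtains t where "c < t" "t < d" "P t"
proof -
  have "\<not> (\<forall>t. c < t \<and> t < d \<longrightarrow> \<not> P t)"
  proof
    assume *: "\<forall>t. c < t \<and> t < d \<longrightarrow> \<not> P t"
    have "AE t in lborel. t \<notin> {c<..<d}"
      using assms(1) by eventually_elim (use * in auto)
    then have "{c<..<d} \<in> null_sets lborel"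
      by (simp add: AE_iff_null_sets)
    then show False using assms(2) by (simp add: null_sets_def)
  qed
  then show ?thesis using that by blast
qed

text \<open>An atom at 0 and a uniform distribution on \<open>[s, e]\<close>; the parameter \<open>c \<le> s\<close> sets the density
  \<open>1 / (e - c)\<close> and hence the mass \<open>(s - c) / (e - c)\<close> of the atom.\<close>

definition bid_dist :: "real \<Rightarrow> real \<Rightarrow> real \<Rightarrow> real measure" where
  "bid_dist c s e = distr (uniform_measure lborel {c..e}) borel (\<lambda>t. if t \<le> s then 0 else t)"

context
  fixes c s e :: real assumes cse: "c \<le> s" "s < e" "0 \<le> s"
begin

interpretation U: prob_space "uniform_measure lborel {c..e}"
  by (rule prob_space_uniform_measure) (use cse in auto)

lemma measure_uniform_lborel:
  "A \<in> sets borel \<Longrightarrow> measure (uniform_measure lborel {c..e}) A = measure lborel ({c..e} \<inter> A) / (e - c)"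
  using cse by (subst measure_uniform_measure) auto

lemma bid_dist_preimage:
  assumes "A \<in> sets borel"
  shows "measure (bid_dist c s e) A =
    measure lborel ({c..e} \<inter> {t. (if t \<le> s then 0 else t) \<in> A}) / (e - c)"
proof -
  have [measurable]: "A \<in> sets borel" by fact
  have "measure (bid_dist c s e) A =
      measure (uniform_measure lborel {c..e}) {t. (if t \<le> s then 0 else t) \<in> A}"
    unfolding bid_dist_def by (subst measure_distr) (auto simp: vimage_def)
  also have "\<dots> = measure lborel ({c..e} \<inter> {t. (if t \<le> s then 0 else t) \<in> A}) / (e - c)"
    by (rule measure_uniform_lborel) measurable
  finally show ?thesis .
qed

lemma mixed_strategy_bid_dist: "mixed_strategy (bid_dist c s e)"
  unfolding bid_dist_def
  by (rule mixed_strategyI)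
    (use cse in \<open>auto intro!: U.prob_space_distr simp: AE_distr_iff\<close>)

lemma bid_dist_singleton:
  "measure (bid_dist c s e) {x} = (if x = 0 then (s - c) / (e - c) else 0)"
proof (cases "x = 0")
  case True
  have "{c..e} \<inter> {t. (if t \<le> s then 0 else t) \<in> {x}} = {c..s}"
    using cse True by auto
  then show ?thesis using True cse by (simp add: bid_dist_preimage)
next
  case False
  have "{c..e} \<inter> {t. (if t \<le> s then 0 else t) \<in> {x}} \<subseteq> {x}"
    using False by (auto split: if_splits)
  then have "emeasure lborel ({c..e} \<inter> {t. (if t \<le> s then 0 else t) \<in> {x}}) \<le> emeasure lborel {x}"
    by (rule emeasure_mono) simp
  then have "measure lborel ({c..e} \<inter> {t. (if t \<le> s then 0 else t) \<in> {x}}) = 0"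
    by (simp add: measure_def)
  then show ?thesis using False by (simp add: bid_dist_preimage)
qed

lemma bid_dist_lessThan:
  "measure (bid_dist c s e) {..<x} =
    (if x \<le> 0 then 0 else if x \<le> s then (s - c) / (e - c) else if x \<le> e then (x - c) / (e - c) else 1)"
proof -
  let ?S = "{c..e} \<inter> {t. (if t \<le> s then 0 else t) \<in> {..<x}}"
  consider "x \<le> 0" | "0 < x" "x \<le> s" | "0 < x" "s < x" "x \<le> e" | "0 < x" "s < x" "e < x"
    by linarith
  then have "measure lborel ?S = (if x \<le> 0 then 0 else if x \<le> s then s - c else if x \<le> e then x - c else e - c)"
  proof cases
    case 1
    then have "?S = {}" using cse by auto
    with 1 show ?thesis by simp
  next
    case 2
    then have "?S = {c..s}" using cse by auto
    with 2 cse show ?thesis by simp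
  next
    case 3
    then have "?S = {c..<x}" using cse by auto
    with 3 cse show ?thesis by simp
  next
    case 4
    then have "?S = {c..e}" using cse by auto
    with 4 cse show ?thesis by simp
  qed
  then show ?thesis using cse by (subst bid_dist_preimage) auto
qed

lemma share_bid_dist:
  "share \<gamma> (bid_dist c s e) x =
    (if x < 0 then 0 else if x = 0 then \<gamma> * ((s - c) / (e - c)) else if x \<le> s then (s - c) / (e - c)
     else if x \<le> e then (x - c) / (e - c) else 1)"
  unfolding share_def bid_dist_singleton bid_dist_lessThan by auto

lemma AE_bid_distI:
  assumes "Measurable.pred borel P" "c < s \<Longrightarrow> P 0" "\<And>t. s < t \<Longrightarrow> t < e \<Longrightarrow> P t"
  shows "AE x in bid_dist c s e. P x"
proof -
  \<comment> \<open>Without the null point c, the case t \<le> s implies c < s, the condition under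
    which P 0 is available.\<close>
  have "AE t in lborel. t \<noteq> c \<and> t \<noteq> e"
    using AE_lborel_singleton[of c] AE_lborel_singleton[of e] by eventually_elim simp
  then have "AE t in lborel. t \<in> {c..e} \<longrightarrow> P (if t \<le> s then 0 else t)"
    by eventually_elim (use assms(2,3) in auto)
  then have "AE t in uniform_measure lborel {c..e}. P (if t \<le> s then 0 else t)"
    by (intro AE_uniform_measureI) simp_all
  then show ?thesis unfolding bid_dist_def
    by (subst AE_distr_iff) (use assms(1) in \<open>auto simp: pred_def\<close>)
qed

lemma AE_bid_distD:
  assumes "AE x in bid_dist c s e. P x"
  shows "AE t in lborel. s < t \<and> t < e \<longrightarrow> P t" "c < s \<Longrightarrow> P 0"
proof -
  have "AE t in uniform_measure lborel {c..e}. P (if t \<le> s then 0 else t)"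
    using assms unfolding bid_dist_def by (rule AE_distrD[rotated]) simp
  then have *: "AE t in lborel. t \<in> {c..e} \<longrightarrow> P (if t \<le> s then 0 else t)"
    by (subst (asm) AE_uniform_measure) (use cse in auto)
  then show "AE t in lborel. s < t \<and> t < e \<longrightarrow> P t"
    by eventually_elim (use cse in auto)
  assume "c < s"
  \<comment> \<open>Every point between c and s is sent to 0, so a single good one suffices.\<close>
  then obtain t where "c < t" "t < s" "t \<in> {c..e} \<longrightarrow> P (if t \<le> s then 0 else t)"
    using AE_lborel_dense[OF *] by blast
  then show "P 0" using cse by simp
qed

end

section \<open>Recovering a distribution function from indifference\<close>

lemma cdf_negative:
  assumes "mixed_strategy X" "x < 0"
  shows "cdf X x = 0"
proof -
  interpret real_distribution X by (rule mixed_strategyD(1)[OF assms(1)])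
  have "AE y in X. y \<notin> {..x}"
    using mixed_strategyD(4)[OF assms(1)] by eventually_elim (use assms(2) in auto)
  then show ?thesis unfolding cdf_def by (subst prob_eq_0) auto
qed

lemma cdf_eq_1_of_AE_le:
  assumes N: "real_distribution N" and "AE y in N. y \<le> r" "r \<le> s"
  shows "cdf N s = 1"
proof -
  interpret real_distribution N by fact
  have "AE y in N. y \<in> {..s}" using assms(2) by eventually_elim (use assms(3) in auto)
  then show ?thesis unfolding cdf_def using prob_eq_1[of "{..s}"] by simp
qed

text \<open>The top r is approached from both sides. Beyond r winning is certain, so V is at least
  \<open>\<kappa> - s\<close> for every s > r; indifferent bids t just below r give V at most
  \<open>\<kappa> - t\<close>. Once V is known, indifference is an affine equation for
  \<open>share\<close>.\<close>

lemma cdf_of_indifference: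
  assumes N: "real_distribution N" and \<gamma>: "0 \<le> \<gamma>" "\<gamma> \<le> 1" and \<kappa>: "0 < \<kappa>" and lr: "l < r"
    and dense: "\<And>c d. l \<le> c \<Longrightarrow> c < d \<Longrightarrow> d \<le> r \<Longrightarrow> \<exists>t. c < t \<and> t < d \<and> \<kappa> * share \<gamma> N t - t = V"
    and le: "\<And>s. l < s \<Longrightarrow> \<kappa> * share \<gamma> N s - s \<le> V"
    and top: "AE y in N. y \<le> r"
  shows "V = \<kappa> - r" "\<And>s. l \<le> s \<Longrightarrow> s < r \<Longrightarrow> cdf N s = (s + \<kappa> - r) / \<kappa>"
proof -
  have "\<kappa> - V \<le> s" if "r < s" for s
  proof -
    have "1 \<le> share \<gamma> N s"
      using cdf_le_share[OF N \<gamma>(1) that] cdf_eq_1_of_AE_le[OF N top] by simp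
    then have "\<kappa> \<le> \<kappa> * share \<gamma> N s" using \<kappa> by simp
    then show ?thesis using le[of s] that lr by simp
  qed
  then have "\<kappa> - V \<le> r" by (rule dense_ge)
  moreover have "V \<le> \<kappa> - r"
  proof (rule ccontr)
    assume "\<not> V \<le> \<kappa> - r"
    then obtain t where t: "max l (\<kappa> - V) < t" "\<kappa> * share \<gamma> N t - t = V"
      using dense[of "max l (\<kappa> - V)" r] lr by auto
    have "\<kappa> * share \<gamma> N t \<le> \<kappa>" using share_le_1[OF N \<gamma>(2)] \<kappa> by simp
    then show False using t by simp
  qed
  ultimately show V: "V = \<kappa> - r" by simp
  show "cdf N s = (s + \<kappa> - r) / \<kappa>" if "l \<le> s" "s < r" for s
  proof (rule cdf_eq_of_share_dense[OF N \<gamma> _ _ that])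
    fix c d assume "l \<le> c" "c < d" "d \<le> r"
    then obtain t where "c < t" "t < d" "\<kappa> * share \<gamma> N t - t = V" using dense by blast
    then show "\<exists>t. c < t \<and> t < d \<and> share \<gamma> N t = (t + \<kappa> - r) / \<kappa>"
      using \<kappa> V by (intro exI[of _ t]) (simp add: field_simps)
  qed (use \<kappa> in \<open>auto intro!: continuous_intros\<close>)
qed

lemma (in real_distribution) expectation_share:
  "expectation (\<lambda>y. indicator {..<s} y + \<gamma> * indicator {s} y) = share \<gamma> M s"
proof -
  have "integrable M (indicator A :: real \<Rightarrow> real)" if "A \<in> sets borel" for A
    using that by (intro integrable_real_indicator) (simp_all add: emeasure_eq_measure)
  then show ?thesis unfolding share_def
    by (subst Bochner_Integration.integral_add) (simp_all add: integrable_mult_right)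
qed

section \<open>Interchangeability of equilibria\<close>

locale auction =
  fixes uA uB p q \<alpha> :: real
  assumes uA: "0 < uA" and uB: "0 < uB" and q: "0 < q" and p: "0 \<le> p"
    and \<alpha>: "0 \<le> \<alpha>" "\<alpha> \<le> 1"
begin

sublocale A: contest uA "\<lambda>x y. win_share \<alpha> x (q * y - p)"
  by standard (use uA \<alpha> in \<open>auto simp: win_share_def\<close>)

sublocale B: contest uB "\<lambda>y x. 1 - win_share \<alpha> x (q * y - p)"
proof
  have [measurable]: "(\<lambda>z. win_share \<alpha> (snd z) (q * fst z - p)) \<in> borel_measurable (borel \<Otimes>\<^sub>M borel)"
    unfolding win_share_def by measurable
  show "(\<lambda>z. 1 - win_share \<alpha> (snd z) (q * fst z - p)) \<in> borel_measurable (borel \<Otimes>\<^sub>M borel)"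
    by measurable
qed (use uB \<alpha> in \<open>auto simp: win_share_def\<close>)

lemma payoff_A: "A.payoff = payoffA uA p q \<alpha>"
  by (intro ext) (simp add: A.payoff_def payoffA_def)

lemma payoff_B: "B.payoff = (\<lambda>y x. payoffB uB p q \<alpha> x y)"
  by (intro ext) (simp add: B.payoff_def payoffB_def)

lemma expected_payoff_B:
  assumes "mixed_strategy M" "mixed_strategy N"
  shows "expected_payoff (payoffB uB p q \<alpha>) M N = expected_payoff B.payoff N M"
  unfolding payoff_B by (rule expected_payoff_swap[OF assms payoffB_measurable])

lemma equilibrium_iff:
  "auction_equilibrium uA uB p q \<alpha> M N \<longleftrightarrow> best_response A.payoff N M \<and> best_response B.payoff M N"
  unfolding auction_equilibrium_def nash_equilibrium_def best_response_def payoff_A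
  by (auto simp: expected_payoff_B)

lemma win_prob_A:
  assumes "mixed_strategy N"
  shows "A.win_prob N x = share \<alpha> N ((x + p) / q)"
proof -
  interpret real_distribution N by (rule mixed_strategyD(1)[OF assms])
  let ?s = "(x + p) / q"
  have "win_share \<alpha> x (q * y - p) = indicator {..<?s} y + \<alpha> * indicator {?s} y" for y
    using q by (auto simp: win_share_def indicator_def field_simps)
  then show ?thesis unfolding A.win_prob_def by (simp add: expectation_share)
qed

lemma win_prob_B:
  assumes "mixed_strategy M"
  shows "B.win_prob M y = share (1 - \<alpha>) M (q * y - p)"
proof -
  interpret real_distribution M by (rule mixed_strategyD(1)[OF assms])
  have "1 - win_share \<alpha> x (q * y - p) = indicator {..<q * y - p} x + (1 - \<alpha>) * indicator {q * y - p} x" for x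
    by (auto simp: win_share_def indicator_def)
  then show ?thesis unfolding B.win_prob_def by (simp add: expectation_share)
qed

lemma expected_win_B:
  assumes M: "mixed_strategy M" and N: "mixed_strategy N"
  shows "(\<integral>y. B.win_prob M y \<partial>N) = 1 - (\<integral>x. A.win_prob N x \<partial>M)"
proof -
  interpret M: prob_space M by (rule mixed_strategyD(2)[OF M])
  interpret N: prob_space N by (rule mixed_strategyD(2)[OF N])
  interpret pair_prob_space M N ..
  have "(\<integral>y. B.win_prob M y \<partial>N) = (\<integral>y. 1 - (\<integral>x. win_share \<alpha> x (q * y - p) \<partial>M) \<partial>N)"
  proof (rule Bochner_Integration.integral_cong)
    fix y
    \<comment> \<open>\<open>A.w_integrable\<close> concerns the variable y; integrability in x
      comes from Player B's winning chance, hence the double complement.\<close>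
    have "integrable M (\<lambda>x. 1 - (1 - win_share \<alpha> x (q * y - p)))"
      by (rule Bochner_Integration.integrable_diff[OF _ B.w_integrable[OF N M, of y]]) simp
    then have "integrable M (\<lambda>x. win_share \<alpha> x (q * y - p))" by simp
    then show "B.win_prob M y = 1 - (\<integral>x. win_share \<alpha> x (q * y - p) \<partial>M)"
      unfolding B.win_prob_def by (simp add: M.prob_space)
  qed simp
  also have "\<dots> = 1 - (\<integral>y. (\<integral>x. win_share \<alpha> x (q * y - p) \<partial>M) \<partial>N)"
    using integrable_snd[of "\<lambda>x y. win_share \<alpha> x (q * y - p)"] A.w_pair_integrable[OF M N]
    by (subst Bochner_Integration.integral_diff) (simp_all add: case_prod_beta' N.prob_space)
  also have "(\<integral>y. (\<integral>x. win_share \<alpha> x (q * y - p) \<partial>M) \<partial>N) = (\<integral>x. A.win_prob N x \<partial>M)"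
    unfolding A.win_prob_def using A.w_pair_integrable[OF M N]
    by (intro Fubini_integral) (simp add: case_prod_beta')
  finally show ?thesis .
qed

lemma equilibrium_interchange:
  assumes "auction_equilibrium uA uB p q \<alpha> M N" "auction_equilibrium uA uB p q \<alpha> M' N'"
  shows "auction_equilibrium uA uB p q \<alpha> M N'"
proof -
  have A: "best_response A.payoff N M" "best_response A.payoff N' M'"
    and B: "best_response B.payoff M N" "best_response B.payoff M' N'"
    using assms by (auto simp: equilibrium_iff)
  then have ms: "mixed_strategy M" "mixed_strategy N" "mixed_strategy M'" "mixed_strategy N'"
    by (auto simp: best_response_def)
  \<comment> \<open>Finite means make all payoffs below real, so that the inequalities can be
    added.\<close>
  have int: "integrable M (\<lambda>x. x)" "integrable M' (\<lambda>x. x)" "integrable N (\<lambda>x. x)" "integrable N' (\<lambda>x. x)"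
    by (rule A.best_responseE[OF A(1) ms(2)], assumption)
      (rule A.best_responseE[OF A(2) ms(4)] B.best_responseE[OF B(1) ms(1)]
        B.best_responseE[OF B(2) ms(3)], assumption)+
  define W where "W X Y = (\<integral>x. A.win_prob Y x \<partial>X)" for X Y
  define E where "E X = (\<integral>x. x \<partial>X)" for X :: "real measure"
  have eA: "expected_payoff A.payoff X Y = ereal (uA * W X Y - E X)"
    if "mixed_strategy X" "mixed_strategy Y" "integrable X (\<lambda>x. x)" for X Y
    using A.expected_payoff_integrable(1)[OF that] by (simp add: W_def E_def)
  have eB: "expected_payoff B.payoff Y X = ereal (uB * (1 - W X Y) - E Y)"
    if "mixed_strategy X" "mixed_strategy Y" "integrable Y (\<lambda>x. x)" for X Y
    using B.expected_payoff_integrable(1)[OF that(2,1,3)] expected_win_B[OF that(1,2)]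
    by (simp add: W_def E_def)
  have "uA * W M' N - E M' \<le> uA * W M N - E M"
    using best_responseD[OF A(1) ms(3)] by (simp add: eA ms int)
  from divide_right_mono[OF this, of uA] have 1: "W M' N - E M' / uA \<le> W M N - E M / uA"
    using uA by (simp add: diff_divide_distrib)
  have "uA * W M N' - E M \<le> uA * W M' N' - E M'"
    using best_responseD[OF A(2) ms(1)] by (simp add: eA ms int)
  from divide_right_mono[OF this, of uA] have 2: "W M N' - E M / uA \<le> W M' N' - E M' / uA"
    using uA by (simp add: diff_divide_distrib)
  have "uB * (1 - W M N') - E N' \<le> uB * (1 - W M N) - E N"
    using best_responseD[OF B(1) ms(4)] by (simp add: eB ms int)
  from divide_right_mono[OF this, of uB] have 3: "1 - W M N' - E N' / uB \<le> 1 - W M N - E N / uB"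
    using uB by (simp add: diff_divide_distrib)
  have "uB * (1 - W M' N) - E N \<le> uB * (1 - W M' N') - E N'"
    using best_responseD[OF B(2) ms(2)] by (simp add: eB ms int)
  from divide_right_mono[OF this, of uB] have 4: "1 - W M' N - E N / uB \<le> 1 - W M' N' - E N' / uB"
    using uB by (simp add: diff_divide_distrib)
  \<comment> \<open>The two sides of the sum of the four deviation inequalities coincide, so each of
    them is an equality. The second makes M optimal against N', the third N' against M.\<close>
  have "W M N' - E M / uA = W M' N' - E M' / uA" using 1 2 3 4 by linarith
  from arg_cong[OF this, of "(*) uA"] have "uA * W M N' - E M = uA * W M' N' - E M'"
    using uA by (simp add: right_diff_distrib)
  then have "best_response A.payoff N' M"
    using A(2) ms(1) by (simp add: best_response_def eA ms int)
  moreover have "1 - W M N' - E N' / uB = 1 - W M N - E N / uB" using 1 2 3 4 by linarith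
  from arg_cong[OF this, of "(*) uB"] have "uB * (1 - W M N') - E N' = uB * (1 - W M N) - E N"
    using uB by (simp add: right_diff_distrib)
  then have "best_response B.payoff M N'"
    using B(1) ms(4) by (simp add: best_response_def eB ms int)
  ultimately show ?thesis by (simp add: equilibrium_iff)
qed

end

section \<open>The contested auction\<close>

lemma (in auction) interim_A:
  "mixed_strategy N \<Longrightarrow> A.interim N x = uA * share \<alpha> N ((x + p) / q) - x"
  by (simp add: A.interim_def win_prob_A)

lemma (in auction) interim_B:
  "mixed_strategy M \<Longrightarrow> B.interim M y = uB * share (1 - \<alpha>) M (q * y - p) - y"
  by (simp add: B.interim_def win_prob_B)

text \<open>The length \<open>L = min uA (q * uB - p)\<close> of the range of contested bids covers cases (ii) and (iii)
  uniformly.\<close>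

locale contested_auction = auction +
  fixes L :: real
  assumes L: "0 < L" "L \<le> uA" "L \<le> q * uB - p" "L = uA \<or> L = q * uB - p"
begin

text \<open>The first parameter is chosen so that the density is \<open>1 / (q * uB)\<close>; the
  atom at 0 has mass \<open>1 - L / (q * uB)\<close>.\<close>

definition strategy_A :: "real measure" where
  "strategy_A = bid_dist (L - q * uB) 0 L"

text \<open>Here the density is \<open>q / uA\<close> and the atom at 0 has mass
  \<open>1 - L / uA\<close>, which vanishes when L = \<open>uA\<close>.\<close>

definition strategy_B :: "real measure" where
  "strategy_B = bid_dist ((L + p - uA) / q) (p / q) ((L + p) / q)"

lemma range_A: "L - q * uB \<le> 0" "0 < L" "(0::real) \<le> 0"
  using L p by auto

lemma range_B: "(L + p - uA) / q \<le> p / q" "p / q < (L + p) / q" "0 \<le> p / q"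
  using L p q by (auto simp: divide_right_mono divide_strict_right_mono)

lemma mixed_strategy_A: "mixed_strategy strategy_A"
  unfolding strategy_A_def by (rule mixed_strategy_bid_dist[OF range_A])

lemma mixed_strategy_B: "mixed_strategy strategy_B"
  unfolding strategy_B_def by (rule mixed_strategy_bid_dist[OF range_B])

text \<open>The only atom is at 0, and it can tie with a bid of Player A only if x = 0 and p = 0;
  this produces the exceptional first case.\<close>

lemma interim_strategy_B:
  assumes "0 \<le> x"
  shows "A.interim strategy_B x =
    (if x = 0 \<and> p = 0 then \<alpha> * (uA - L) else if x \<le> L then uA - L else uA - x)"
proof -
  have l: "(L + p) / q - (L + p - uA) / q = uA / q" "p / q - (L + p - uA) / q = (uA - L) / q"
    "(x + p) / q - (L + p - uA) / q = (x + uA - L) / q"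
    by (simp_all add: diff_divide_distrib[symmetric])
  have "(x + p) / q \<ge> 0" "(x + p) / q = 0 \<longleftrightarrow> x = 0 \<and> p = 0"
    "(x + p) / q \<le> p / q \<longleftrightarrow> x = 0" "(x + p) / q \<le> (L + p) / q \<longleftrightarrow> x \<le> L"
    using assms p q by (auto simp: divide_le_cancel add_nonneg_eq_0_iff)
  then show ?thesis
    unfolding interim_A[OF mixed_strategy_B] unfolding strategy_B_def share_bid_dist[OF range_B] l
    using assms uA q L by auto
qed

lemma interim_strategy_A:
  assumes "0 \<le> y"
  shows "B.interim strategy_A y =
    (if q * y < p then - y else if q * y = p then (1 - \<alpha>) * (uB - L / q) - y
     else if y \<le> (L + p) / q then uB - (L + p) / q else uB - y)"
proof -
  have l: "y \<le> (L + p) / q \<longleftrightarrow> q * y - p \<le> L" using q by (auto simp: field_simps)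
  have "uB * ((1 - \<alpha>) * ((0 - (L - q * uB)) / (L - (L - q * uB)))) = (1 - \<alpha>) * (uB - L / q)"
    using uB q by (simp add: field_simps)
  moreover have "uB * ((q * y - p - (L - q * uB)) / (L - (L - q * uB))) - y = uB - (L + p) / q"
    using uB q by (simp add: field_simps)
  ultimately show ?thesis
    unfolding interim_B[OF mixed_strategy_A] l
    unfolding strategy_A_def share_bid_dist[OF range_A] by auto
qed

lemma value_B_nonneg: "0 \<le> uB - (L + p) / q"
  using L q by (simp add: field_simps)

lemma equilibrium_strategies: "auction_equilibrium uA uB p q \<alpha> strategy_A strategy_B"
  unfolding equilibrium_iff
proof
  show "best_response A.payoff strategy_B strategy_A"
  proof (rule A.best_responseI[OF mixed_strategy_A mixed_strategy_B])
    have [measurable]: "A.interim strategy_B \<in> borel_measurable borel"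
      using A.interim_measurable[OF mixed_strategy_A mixed_strategy_B]
      unfolding measurable_cong_sets[OF mixed_strategyD(3)[OF mixed_strategy_A] refl] .
    show "AE x in strategy_A. A.interim strategy_B x = uA - L"
      unfolding strategy_A_def
    proof (rule AE_bid_distI[OF range_A])
      assume "L - q * uB < 0"
      \<comment> \<open>If p = 0, then L < \<open>q * uB\<close> forces L = \<open>uA\<close>, and
        the tie value \<open>\<alpha> * (uA - L)\<close> is harmless because both sides are
        0.\<close>
      then show "A.interim strategy_B 0 = uA - L"
        using L p by (auto simp: interim_strategy_B)
    qed (auto simp: interim_strategy_B)
    show "A.interim strategy_B x \<le> uA - L" if "0 \<le> x" for x
      using that L \<alpha> mult_right_mono[of \<alpha> 1 "uA - L"] by (simp add: interim_strategy_B)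
  qed
  show "best_response B.payoff strategy_A strategy_B"
  proof (rule B.best_responseI[OF mixed_strategy_B mixed_strategy_A])
    have [measurable]: "B.interim strategy_A \<in> borel_measurable borel"
      using B.interim_measurable[OF mixed_strategy_B mixed_strategy_A]
      unfolding measurable_cong_sets[OF mixed_strategyD(3)[OF mixed_strategy_B] refl] .
    show "AE y in strategy_B. B.interim strategy_A y = uB - (L + p) / q"
      unfolding strategy_B_def
    proof (rule AE_bid_distI[OF range_B])
      \<comment> \<open>An atom of Player B at 0 means L < \<open>uA\<close>, hence L =
        \<open>q * uB - p\<close>: the value of B is 0, which is what the bid 0 earns.\<close>
      assume "(L + p - uA) / q < p / q"
      then have "L = q * uB - p" using L q by (auto simp: field_simps)
      then have W: "uB - (L + p) / q = 0" using q by (simp add: field_simps)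
      then have "uB - L / q = 0" if "p = 0" using that by simp
      then have "B.interim strategy_A 0 = 0" using p by (simp add: interim_strategy_A)
      with W show "B.interim strategy_A 0 = uB - (L + p) / q" by simp
    next
      fix y assume y: "p / q < y" "y < (L + p) / q"
      then have "0 \<le> y" "p < q * y" using p q by (auto simp: field_simps intro: order_trans[OF range_B(3)])
      then show "B.interim strategy_A y = uB - (L + p) / q"
        using y by (simp add: interim_strategy_A)
    qed auto
    show "B.interim strategy_A y \<le> uB - (L + p) / q" if y: "0 \<le> y" for y
    proof -
      have "(1 - \<alpha>) * (uB - L / q) - y \<le> uB - (L + p) / q" if "q * y = p"
      proof -
        have "y = p / q" using that q by (simp add: field_simps)
        moreover have "(1 - \<alpha>) * (uB - L / q) \<le> 1 * (uB - L / q)"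
          using \<alpha> L p q by (intro mult_right_mono) (auto simp: field_simps)
        ultimately show ?thesis by (simp add: add_divide_distrib)
      qed
      then show ?thesis using y value_B_nonneg by (simp add: interim_strategy_A)
    qed
  qed
qed

section \<open>Arbitrary equilibria of the contested auction\<close>

context
  fixes M N assumes eq: "auction_equilibrium uA uB p q \<alpha> M N"
begin

lemma equilibrium_mixed: "mixed_strategy M" "mixed_strategy N"
  using eq by (auto simp: equilibrium_iff best_response_def)

lemma best_responses:
  "best_response A.payoff N M" "best_response A.payoff N strategy_A" "best_response A.payoff strategy_B M"
  "best_response B.payoff M N" "best_response B.payoff M strategy_B" "best_response B.payoff strategy_A N"
  using eq equilibrium_interchange[OF eq equilibrium_strategies]
    equilibrium_interchange[OF equilibrium_strategies eq]
  by (auto simp: equilibrium_iff)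

text \<open>Against \<open>strategy_B\<close> the bid L already wins almost surely, so any higher
  bid only costs more.\<close>

lemma AE_bid_A: "AE x in M. x \<le> L"
proof -
  obtain V where V: "AE x in M. A.interim strategy_B x = V" "\<And>x. 0 \<le> x \<Longrightarrow> A.interim strategy_B x \<le> V"
    using A.best_responseE[OF best_responses(3) mixed_strategy_B] by metis
  have W: "uA - L \<le> V" using V(2)[of L] L by (simp add: interim_strategy_B)
  show ?thesis
    using V(1) mixed_strategyD(4)[OF equilibrium_mixed(1)]
    by eventually_elim (use W L in \<open>auto simp: interim_strategy_B split: if_splits\<close>)
qed

text \<open>Against \<open>strategy_A\<close>, a bid above the range overpays, and a positive bid
  below p / q surely loses and earns less than the nonnegative value. With \<open>\<alpha>\<close> =
  1 the bid p / q loses too, since it can at best tie.\<close>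

lemma AE_bid_B: "AE y in N. y \<le> (L + p) / q \<and> (0 < y \<longrightarrow> p / q \<le> y) \<and> (\<alpha> = 1 \<and> 0 < p \<longrightarrow> y \<noteq> p / q)"
proof -
  obtain V where V: "AE y in N. B.interim strategy_A y = V" "\<And>y. 0 \<le> y \<Longrightarrow> B.interim strategy_A y \<le> V"
    using B.best_responseE[OF best_responses(6) mixed_strategy_A] by metis
  have "(L + p) / q > 0" using L p q by simp
  then have W: "uB - (L + p) / q \<le> V"
    using V(2)[of "(L + p) / q"] L q by (simp add: interim_strategy_A)
  show ?thesis
    using V(1) mixed_strategyD(4)[OF equilibrium_mixed(2)]
  proof eventually_elim
    case (elim y)
    have "y \<le> (L + p) / q"
    proof (rule ccontr)
      assume *: "\<not> y \<le> (L + p) / q"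
      then have "L + p < q * y" using q by (simp add: field_simps)
      then show False using elim * W L by (simp add: interim_strategy_A split: if_splits)
    qed
    moreover have "p / q \<le> y" if "0 < y"
    proof (rule ccontr)
      assume "\<not> p / q \<le> y"
      then have "q * y < p" using q by (simp add: field_simps)
      then show False using elim that W value_B_nonneg by (simp add: interim_strategy_A)
    qed
    moreover have "y \<noteq> p / q" if "\<alpha> = 1" "0 < p"
    proof
      assume y: "y = p / q"
      then have "q * y = p" "0 < y" using q that by simp_all
      then have "(1 - \<alpha>) * (uB - L / q) - y = V" using elim by (simp add: interim_strategy_A)
      then show False using \<open>0 < y\<close> that(1) W value_B_nonneg by simp
    qed
    ultimately show ?case by blast
  qed
qed

text \<open>The claim about the bid 0 rests on the atom of \<open>strategy_A\<close>, present when L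
  < \<open>q * uB\<close>: optimality holds at an atom exactly, not just almost everywhere.\<close>

lemma equilibrium_A:
  shows payoff_equilibrium_A: "expected_payoff (payoffA uA p q \<alpha>) M N = ereal (uA - L)"
    and interim_equilibrium_A: "L < q * uB \<Longrightarrow> A.interim N 0 = uA - L"
    and cdf_B_contested: "\<And>y. p / q \<le> y \<Longrightarrow> y < (L + p) / q \<Longrightarrow> cdf N y = 1 - L / uA + (q * y - p) / uA"
proof -
  note N = equilibrium_mixed(2)
  obtain V where V: "expected_payoff A.payoff M N = ereal V" "\<And>x. 0 \<le> x \<Longrightarrow> A.interim N x \<le> V"
    using A.best_responseE[OF best_responses(1) N] by metis
  obtain V' where V': "expected_payoff A.payoff strategy_A N = ereal V'"
    "AE x in strategy_A. A.interim N x = V'"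
    using A.best_responseE[OF best_responses(2) N] by metis
  have [simp]: "V' = V"
    using best_responseD[OF best_responses(1) mixed_strategy_A]
      best_responseD[OF best_responses(2) equilibrium_mixed(1)] V(1) V'(1) by simp
  note AE = AE_bid_distD[OF range_A V'(2)[unfolded strategy_A_def]]
  \<comment> \<open>On the scale s = (x + p) / q of Player B's bids, A's payoff takes the form of
    \<open>cdf_of_indifference\<close> with \<open>\<kappa>\<close> = \<open>uA / q\<close>.\<close>
  have rescale: "uA / q * share \<alpha> N s - s = (A.interim N (q * s - p) - p) / q" for s
  proof -
    have "(q * s - p + p) / q = s" using q by simp
    then show ?thesis unfolding interim_A[OF N] using q by (simp add: diff_divide_distrib)
  qed
  have val: "(V - p) / q = uA / q - (L + p) / q \<and>
      (\<forall>s. p / q \<le> s \<longrightarrow> s < (L + p) / q \<longrightarrow> cdf N s = (s + uA / q - (L + p) / q) / (uA / q))"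
  proof (intro conjI allI impI)
    have *: "\<exists>t>c. t < d \<and> uA / q * share \<alpha> N t - t = (V - p) / q"
      if "p / q \<le> c" "c < d" "d \<le> (L + p) / q" for c d
    proof -
      have "q * c - p < q * d - p" using that q by simp
      then obtain x where x: "q * c - p < x" "x < q * d - p" "0 < x \<and> x < L \<longrightarrow> A.interim N x = V'"
        using AE_lborel_dense[OF AE(1)] by blast
      from x that q have "0 < x" "x < L" by (auto simp: field_simps)
      then have i: "A.interim N x = V" using x(3) by simp
      have e: "q * ((x + p) / q) - p = x" using q by simp
      have "uA / q * share \<alpha> N ((x + p) / q) - (x + p) / q = (V - p) / q"
        unfolding rescale e i ..
      moreover have "c < (x + p) / q" "(x + p) / q < d" using x q by (simp_all add: field_simps)
      ultimately show ?thesis by blast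
    qed
    have **: "uA / q * share \<alpha> N s - s \<le> (V - p) / q" if "p / q < s" for s
    proof -
      have "0 \<le> q * s - p" using that q by (simp add: field_simps)
      then show ?thesis unfolding rescale using V(2) q by (intro divide_right_mono) simp_all
    qed
    have ***: "AE y in N. y \<le> (L + p) / q" using AE_bid_B by eventually_elim simp
    have pos: "0 < uA / q" using uA q by simp
    note c = cdf_of_indifference[OF mixed_strategyD(1)[OF N] \<alpha> pos range_B(2) * ** ***]
    show "(V - p) / q = uA / q - (L + p) / q" using c(1) by blast
    show "cdf N s = (s + uA / q - (L + p) / q) / (uA / q)" if "p / q \<le> s" "s < (L + p) / q" for s
      using c(2) that by blast
  qed
  then have [simp]: "V = uA - L" using q by (simp add: field_simps)
  show "expected_payoff (payoffA uA p q \<alpha>) M N = ereal (uA - L)"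
    using V(1) by (simp add: payoff_A)
  show "A.interim N 0 = uA - L" if "L < q * uB" using AE(2) that by simp
  show "cdf N y = 1 - L / uA + (q * y - p) / uA" if "p / q \<le> y" "y < (L + p) / q" for y
  proof -
    have "cdf N y = (y + uA / q - (L + p) / q) / (uA / q)" using val that by blast
    also have "\<dots> = 1 - L / uA + (q * y - p) / uA" using uA q by (simp add: field_simps)
    finally show ?thesis .
  qed
qed

lemma equilibrium_B:
  shows payoff_equilibrium_B: "expected_payoff (payoffB uB p q \<alpha>) M N = ereal (uB - (L + p) / q)"
    and cdf_A_contested: "\<And>x. 0 \<le> x \<Longrightarrow> x < L \<Longrightarrow> cdf M x = 1 - L / (q * uB) + x / (q * uB)"
proof -
  note M = equilibrium_mixed(1)
  obtain V where V: "expected_payoff B.payoff N M = ereal V" "\<And>x. 0 \<le> x \<Longrightarrow> B.interim M x \<le> V"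
    using B.best_responseE[OF best_responses(4) M] by metis
  obtain V' where V': "expected_payoff B.payoff strategy_B M = ereal V'"
    "AE x in strategy_B. B.interim M x = V'"
    using B.best_responseE[OF best_responses(5) M] by metis
  have [simp]: "V' = V"
    using best_responseD[OF best_responses(4) mixed_strategy_B]
      best_responseD[OF best_responses(5) equilibrium_mixed(2)] V(1) V'(1) by simp
  note AE = AE_bid_distD(1)[OF range_B V'(2)[unfolded strategy_B_def]]
  \<comment> \<open>The inverse change of scale s = q * y - p, now with \<open>\<kappa>\<close> =
    \<open>q * uB\<close>.\<close>
  have rescale: "q * uB * share (1 - \<alpha>) M s - s = q * B.interim M ((s + p) / q) + p" for s
  proof -
    have "q * ((s + p) / q) - p = s" using q by simp
    then show ?thesis unfolding interim_B[OF M] using q by (simp add: right_diff_distrib)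
  qed
  have *: "\<exists>t>c. t < d \<and> q * uB * share (1 - \<alpha>) M t - t = q * V + p"
    if "0 \<le> c" "c < d" "d \<le> L" for c d
  proof -
    have "(c + p) / q < (d + p) / q" using that q by (simp add: divide_strict_right_mono)
    then obtain y where "(c + p) / q < y" "y < (d + p) / q"
      "p / q < y \<and> y < (L + p) / q \<longrightarrow> B.interim M y = V'"
      using AE_lborel_dense[OF AE] by blast
    moreover from this have "p / q < y" "y < (L + p) / q"
      using that q divide_right_mono[of "d + p" "L + p" q] divide_right_mono[of p "c + p" q] by linarith+
    moreover have "(q * y - p + p) / q = y" using q by simp
    ultimately have "c < q * y - p" "q * y - p < d"
      "q * uB * share (1 - \<alpha>) M (q * y - p) - (q * y - p) = q * V + p"
      using q by (auto simp: rescale pos_less_divide_eq pos_divide_less_eq mult.commute)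
    then show ?thesis by blast
  qed
  have **: "q * uB * share (1 - \<alpha>) M s - s \<le> q * V + p" if "0 < s" for s
    using V(2)[of "(s + p) / q"] that p q by (simp add: rescale)
  have pos: "0 < q * uB" "0 \<le> 1 - \<alpha>" "1 - \<alpha> \<le> 1" using uB q \<alpha> by simp_all
  note c = cdf_of_indifference[OF mixed_strategyD(1)[OF M] pos(2,3,1) range_A(2) * ** AE_bid_A]
  have "q * V + p = q * uB - L" using c(1) by blast
  then have "V = uB - (L + p) / q" using q by (simp add: field_simps)
  then show "expected_payoff (payoffB uB p q \<alpha>) M N = ereal (uB - (L + p) / q)"
    using V(1) by (simp add: expected_payoff_B equilibrium_mixed)
  show "cdf M x = 1 - L / (q * uB) + x / (q * uB)" if "0 \<le> x" "x < L" for x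
  proof -
    have "cdf M x = (x + q * uB - L) / (q * uB)" using c(2) that by blast
    then show ?thesis using uB q by (simp add: field_simps)
  qed
qed

lemma cdf_equilibrium_A:
  "cdf M x = (if x < 0 then 0 else if x \<le> L then 1 - L / (q * uB) + x / (q * uB) else 1)"
  using cdf_negative[OF equilibrium_mixed(1)] cdf_A_contested[of x]
    cdf_eq_1_of_AE_le[OF mixed_strategyD(1)[OF equilibrium_mixed(1)] AE_bid_A, of x]
  by (cases "x = L") auto

text \<open>The jump of \<open>cdf N\<close> at \<open>p / q\<close> has to be excluded: if \<open>\<alpha> < 1\<close>, it would make the zero bid
  of Player A, which is optimal, worse than a small positive bid; if \<open>\<alpha> = 1\<close>, Player B loses the tie.\<close>

lemma cdf_B_uncontested:
  assumes y: "0 \<le> y" "y < p / q"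
  shows "cdf N y = 1 - L / uA"
proof -
  note N = equilibrium_mixed(2)
  interpret real_distribution N by (rule mixed_strategyD(1)[OF N])
  have p0: "0 < p" using y p q by (cases "p = 0") auto
  have c: "share 1 N (p / q) = 1 - L / uA"
    using cdf_B_contested[of "p / q"] range_B(2) q by (simp add: cdf_eq_share[OF real_distribution_axioms])
  have "uA * share 1 N (p / q) = uA - L" using c uA by (simp add: right_diff_distrib)
  moreover have "uA * share \<alpha> N (p / q) = uA - L"
    using interim_equilibrium_A L p0 by (simp add: interim_A[OF N])
  ultimately have "share \<alpha> N (p / q) = share 1 N (p / q)"
    using uA by (metis less_irrefl mult_left_cancel)
  then have "(1 - \<alpha>) * prob {p / q} = 0" using uA by (simp add: share_def algebra_simps)
  moreover have "prob {p / q} = 0" if "\<alpha> = 1"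
  proof -
    have "AE y in N. y \<notin> {p / q}"
      using AE_bid_B by eventually_elim (use that p0 in auto)
    then show ?thesis by (subst prob_eq_0) auto
  qed
  ultimately have "prob {p / q} = 0" by auto
  then have "prob {..<p / q} = 1 - L / uA" using c by (simp add: share_def)
  \<comment> \<open>Player B almost never bids strictly between 0 and p / q, so the two events agree
    almost surely.\<close>
  moreover have "cdf N y = prob {..<p / q}"
    unfolding cdf_def
  proof (rule finite_measure_eq_AE)
    show "AE x in N. x \<in> {..y} \<longleftrightarrow> x \<in> {..<p / q}"
      using AE_bid_B by eventually_elim (use y in auto)
  qed auto
  ultimately show ?thesis by simp
qed

lemma cdf_equilibrium_B:
  "cdf N y = (if y < 0 then 0 else if y < p / q then 1 - L / uA
     else if y \<le> (L + p) / q then 1 - L / uA + (q * y - p) / uA else 1)"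
proof (cases "y < (L + p) / q")
  case True
  then show ?thesis
    using cdf_negative[OF equilibrium_mixed(2)] cdf_B_uncontested[of y] cdf_B_contested[of y] by auto
next
  case False
  have "AE y in N. y \<le> (L + p) / q" using AE_bid_B by eventually_elim simp
  then have "cdf N y = 1"
    using cdf_eq_1_of_AE_le[OF mixed_strategyD(1)[OF equilibrium_mixed(2)], of "(L + p) / q" y] False
    by simp
  \<comment> \<open>At the right end itself the affine branch applies and also gives 1.\<close>
  moreover have "q * y = L + p" if "y \<le> (L + p) / q" using False that q by (simp add: field_simps)
  moreover have "p / q \<le> y" "0 \<le> y" using False range_B by linarith+
  ultimately show ?thesis using uA by auto
qed

end

text \<open>A point mass has a distribution function with values 0 and 1 only, whereas in
  equilibrium that of Player A lies strictly between them at L / 2.\<close>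

lemma no_pure_equilibrium: "\<not> pure_auction_equilibrium uA uB p q \<alpha> xA xB"
proof
  assume "pure_auction_equilibrium uA uB p q \<alpha> xA xB"
  then have eq: "auction_equilibrium uA uB p q \<alpha> (pure_strategy xA) (pure_strategy xB)"
    by (simp add: pure_auction_equilibrium_def)
  have "cdf (pure_strategy xA) (L / 2) = 1 - L / (2 * (q * uB))"
    using L q uB by (subst cdf_equilibrium_A[OF eq]) (simp add: field_simps)
  moreover have "cdf (pure_strategy xA) (L / 2) \<in> {0, 1}"
    by (simp add: cdf_def pure_strategy_def measure_return indicator_def)
  ultimately show False using L p q uB by (auto simp: field_simps)
qed

lemma unique_equilibrium: "\<exists>!S. auction_equilibrium uA uB p q \<alpha> (fst S) (snd S)"
proof (rule ex1I[of _ "(strategy_A, strategy_B)"])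
  show "auction_equilibrium uA uB p q \<alpha> (fst (strategy_A, strategy_B)) (snd (strategy_A, strategy_B))"
    using equilibrium_strategies by simp
  fix S assume S: "auction_equilibrium uA uB p q \<alpha> (fst S) (snd S)"
  have "fst S = strategy_A"
    by (intro cdf_unique ext mixed_strategyD(1) equilibrium_mixed[OF S] mixed_strategy_A)
      (simp add: cdf_equilibrium_A[OF S] cdf_equilibrium_A[OF equilibrium_strategies])
  moreover have "snd S = strategy_B"
    by (intro cdf_unique ext mixed_strategyD(1) equilibrium_mixed[OF S] mixed_strategy_B)
      (simp add: cdf_equilibrium_B[OF S] cdf_equilibrium_B[OF equilibrium_strategies])
  ultimately show "S = (strategy_A, strategy_B)" by (simp add: prod_eq_iff)
qed

end

section \<open>The uncontested auction\<close>

text \<open>To overcome the head start p > 0, Player B must bid at least p / q, which is at least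
  \<open>uB\<close>. Conversely, an equilibrium bid of B is at most \<open>uB\<close>, so B could
  win at most by a tie with the bid 0 of Player A.\<close>

lemma (in auction) uncontested_equilibrium:
  assumes "q * uB - p \<le> 0"
  shows "pure_auction_equilibrium uA uB p q \<alpha> xA xB \<longleftrightarrow> xA = 0 \<and> xB = 0"
proof -
  have p0: "0 < p" using mult_pos_pos[OF q uB] assms by simp
  have pure: "mixed_strategy (pure_strategy x)" if "0 \<le> x" for x
    using that by (simp add: mixed_strategy_pure)
  have AE_pure: "AE y in pure_strategy x. P y" if "P x" for P and x :: real
    unfolding pure_strategy_def by (rule AE_I'[of "- {x}"]) (use that in \<open>auto simp: null_sets_def\<close>)
  have iA: "A.interim (pure_strategy y) x = payoffA uA p q \<alpha> x y" if "0 \<le> x" "0 \<le> y" for x y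
    using A.expected_payoff_pure_left[OF that(1) pure[OF that(2)]]
      expected_payoff_pure[of "payoffA uA p q \<alpha>", OF payoffA_measurable, of x y]
    by (simp add: payoff_A)
  have iB: "B.interim (pure_strategy x) y = payoffB uB p q \<alpha> x y" if "0 \<le> x" "0 \<le> y" for x y
    using B.expected_payoff_pure_left[OF that(2) pure[OF that(1)]]
      expected_payoff_pure[of "payoffB uB p q \<alpha>", OF payoffB_measurable, of x y]
      expected_payoff_B[OF pure[OF that(1)] pure[OF that(2)]]
    by simp
  show ?thesis
  proof
    assume "xA = 0 \<and> xB = 0"
    moreover have "best_response A.payoff (pure_strategy 0) (pure_strategy 0)"
    proof (rule A.best_responseI)
      show "AE x in pure_strategy 0. A.interim (pure_strategy 0) x = uA"
        by (rule AE_pure) (use p0 in \<open>simp add: iA, simp add: payoffA_def win_share_def\<close>)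
      show "A.interim (pure_strategy 0) x \<le> uA" if "0 \<le> x" for x
        unfolding iA[OF that order_refl] using that p0 by (simp add: payoffA_def win_share_def)
    qed (simp_all add: pure)
    moreover have "best_response B.payoff (pure_strategy 0) (pure_strategy 0)"
    proof (rule B.best_responseI)
      show "AE x in pure_strategy 0. B.interim (pure_strategy 0) x = 0"
        by (rule AE_pure) (use p0 in \<open>simp add: iB, simp add: payoffB_def win_share_def\<close>)
      have "payoffB uB p q \<alpha> 0 y \<le> 0" if "0 \<le> y" for y
      proof (cases "p \<le> q * y")
        case True
        then have "q * uB \<le> q * y" using assms by simp
        then have y: "uB \<le> y" using q by simp
        have "uB * (1 - \<alpha>) \<le> uB" using uB \<alpha> by simp
        from this y have "uB * (1 - \<alpha>) \<le> y" by (rule order_trans)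
        with y show ?thesis using that uB by (simp add: payoffB_def win_share_def)
      next
        case False
        then show ?thesis using that by (simp add: payoffB_def win_share_def)
      qed
      then show "B.interim (pure_strategy 0) y \<le> 0" if "0 \<le> y" for y
        unfolding iB[OF order_refl that] using that by blast
    qed (simp_all add: pure)
    ultimately show "pure_auction_equilibrium uA uB p q \<alpha> xA xB"
      by (simp add: pure_auction_equilibrium_def equilibrium_iff)
  next
    assume "pure_auction_equilibrium uA uB p q \<alpha> xA xB"
    then have br: "best_response A.payoff (pure_strategy xB) (pure_strategy xA)"
      "best_response B.payoff (pure_strategy xA) (pure_strategy xB)"
      by (simp_all add: pure_auction_equilibrium_def equilibrium_iff)
    then have x: "0 \<le> xA" "0 \<le> xB" by (simp_all add: best_response_def mixed_strategy_pure)
    have A: "payoffA uA p q \<alpha> x xB \<le> payoffA uA p q \<alpha> xA xB" if "0 \<le> x" for x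
      using best_responseD[OF br(1) pure[OF that]] x that
      by (simp add: A.expected_payoff_pure_left pure iA)
    have B: "payoffB uB p q \<alpha> xA 0 \<le> payoffB uB p q \<alpha> xA xB"
      using best_responseD[OF br(2) pure[of 0]] x
      by (simp add: B.expected_payoff_pure_left pure iB)
    have "payoffB uB p q \<alpha> xA 0 = 0" using x p0 by (simp add: payoffB_def win_share_def)
    with B have B': "xB \<le> uB * (1 - win_share \<alpha> xA (q * xB - p))"
      unfolding payoffB_def[of _ _ _ _ _ xB] by simp
    have share0: "0 \<le> win_share \<alpha> xA (q * xB - p)" using \<alpha> by (simp add: win_share_def)
    have "xB \<le> uB"
      using B' mult_left_mono[OF share0, of uB] uB by (simp add: right_diff_distrib)
    then have "q * xB \<le> q * uB" using q by simp
    then have le: "q * xB - p \<le> 0" using assms by simp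
    have "xB = 0"
    proof (cases "q * xB - p < xA")
      case True
      then show ?thesis using B' x by (simp add: win_share_def)
    next
      case False
      then have xA: "xA = 0" "q * xB - p = 0" using le x by simp_all
      \<comment> \<open>A could break the tie at an arbitrarily small cost, so the tie must already
        award her the item: \<open>\<alpha>\<close> = 1, and B earns nothing from it.\<close>
      have "uA \<le> uA * \<alpha> + \<epsilon>" if "0 < \<epsilon>" for \<epsilon>
        using A[of \<epsilon>] that unfolding payoffA_def win_share_def xA by simp
      then have "uA \<le> uA * \<alpha>" by (rule field_le_epsilon)
      then have "\<alpha> = 1" using uA \<alpha> by simp
      then show ?thesis using B' xA x by (simp add: win_share_def)
    qed
    moreover from this have "xA = 0"
      using A[of 0] x p0 by (auto simp: payoffA_def win_share_def)
    ultimately show "xA = 0 \<and> xB = 0" by simp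
  qed
qed

theorem theorem3p1:
  fixes uA uB p q \<alpha> :: real
  assumes "uA > 0" and "uB > 0" and "q > 0" and "p \<ge> 0" and "0 \<le> \<alpha>" and "\<alpha> \<le> 1"
  shows
    "(q * uB - p \<le> 0 \<longrightarrow>
        (\<exists>!x. pure_auction_equilibrium uA uB p q \<alpha> (fst x) (snd x)) \<and>
        pure_auction_equilibrium uA uB p q \<alpha> 0 0 \<and>
        payoffA uA p q \<alpha> 0 0 = uA \<and>
        payoffB uB p q \<alpha> 0 0 = 0)
   \<and> (0 < q * uB - p \<and> q * uB - p \<le> uA \<longrightarrow>
        \<not> (\<exists>xA xB. pure_auction_equilibrium uA uB p q \<alpha> xA xB) \<and>
        (\<exists>!S. auction_equilibrium uA uB p q \<alpha> (fst S) (snd S)) \<and>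
        (\<forall>M N. auction_equilibrium uA uB p q \<alpha> M N \<longrightarrow>
           cdf M = F_A2 uB p q \<and>
           cdf N = F_B2 uA uB p q \<and>
           expected_payoff (payoffA uA p q \<alpha>) M N = ereal (uA - q * uB + p) \<and>
           expected_payoff (payoffB uB p q \<alpha>) M N = 0))
   \<and> (q * uB - p > uA \<longrightarrow>
        \<not> (\<exists>xA xB. pure_auction_equilibrium uA uB p q \<alpha> xA xB) \<and>
        (\<exists>!S. auction_equilibrium uA uB p q \<alpha> (fst S) (snd S)) \<and>
        (\<forall>M N. auction_equilibrium uA uB p q \<alpha> M N \<longrightarrow>
           cdf M = F_A3 uA uB q \<and>
           cdf N = F_B3 uA p q \<and>
           expected_payoff (payoffA uA p q \<alpha>) M N = 0 \<and>
           expected_payoff (payoffB uB p q \<alpha>) M N = ereal (uB - (uA + p) / q)))"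
proof (intro conjI impI)
  interpret auction uA uB p q \<alpha> by standard fact+
  assume le: "q * uB - p \<le> 0"
  note pure = uncontested_equilibrium[OF le]
  have "0 < q * uB" using assms by simp
  then have "0 < p" using le by simp
  show "\<exists>!x. pure_auction_equilibrium uA uB p q \<alpha> (fst x) (snd x)"
    by (rule ex1I[of _ "(0, 0)"]) (auto simp: pure prod_eq_iff)
  show "pure_auction_equilibrium uA uB p q \<alpha> 0 0" by (simp add: pure)
  show "payoffA uA p q \<alpha> 0 0 = uA" "payoffB uB p q \<alpha> 0 0 = 0"
    using \<open>0 < p\<close> by (simp_all add: payoffA_def payoffB_def win_share_def)
next
  assume "0 < q * uB - p \<and> q * uB - p \<le> uA"
  then interpret contested_auction uA uB p q \<alpha> "q * uB - p"
    by unfold_locales (use assms in auto)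
  show "\<not> (\<exists>xA xB. pure_auction_equilibrium uA uB p q \<alpha> xA xB)"
    by (simp add: no_pure_equilibrium)
  show "\<exists>!S. auction_equilibrium uA uB p q \<alpha> (fst S) (snd S)"
    by (rule unique_equilibrium)
  have e: "1 - (q * uB - p) / (q * uB) = p / (q * uB)" "(q * uB - p + p) / q = uB"
    "1 - (q * uB - p) / uA = 1 - q * uB / uA + p / uA"
    "1 - q * uB / uA + p / uA + (q * y - p) / uA = 1 - q * uB / uA + q * y / uA" for y
    using assms by (simp_all add: diff_divide_distrib)
  show "\<forall>M N. auction_equilibrium uA uB p q \<alpha> M N \<longrightarrow>
           cdf M = F_A2 uB p q \<and>
           cdf N = F_B2 uA uB p q \<and>
           expected_payoff (payoffA uA p q \<alpha>) M N = ereal (uA - q * uB + p) \<and>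
           expected_payoff (payoffB uB p q \<alpha>) M N = 0"
  proof (intro allI impI conjI ext)
    fix M N assume eq: "auction_equilibrium uA uB p q \<alpha> M N"
    show "cdf M x = F_A2 uB p q x" "cdf N x = F_B2 uA uB p q x" for x
      unfolding cdf_equilibrium_A[OF eq] cdf_equilibrium_B[OF eq] F_A2_def F_B2_def e by simp_all
    show "expected_payoff (payoffA uA p q \<alpha>) M N = ereal (uA - q * uB + p)"
      unfolding payoff_equilibrium_A[OF eq] by simp
    show "expected_payoff (payoffB uB p q \<alpha>) M N = 0"
      unfolding payoff_equilibrium_B[OF eq] e by simp
  qed
next
  assume "uA < q * uB - p"
  then interpret contested_auction uA uB p q \<alpha> uA
    by unfold_locales (use assms in auto)
  show "\<not> (\<exists>xA xB. pure_auction_equilibrium uA uB p q \<alpha> xA xB)"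
    by (simp add: no_pure_equilibrium)
  show "\<exists>!S. auction_equilibrium uA uB p q \<alpha> (fst S) (snd S)"
    by (rule unique_equilibrium)
  \<comment> \<open>Rewriting with the first identity leaves the leading 0 that the second one
    matches.\<close>
  have e: "1 - uA / uA = 0" "0 + (q * y - p) / uA = - (p / uA) + q * y / uA" for y
    using assms by (simp_all add: diff_divide_distrib)
  show "\<forall>M N. auction_equilibrium uA uB p q \<alpha> M N \<longrightarrow>
           cdf M = F_A3 uA uB q \<and>
           cdf N = F_B3 uA p q \<and>
           expected_payoff (payoffA uA p q \<alpha>) M N = 0 \<and>
           expected_payoff (payoffB uB p q \<alpha>) M N = ereal (uB - (uA + p) / q)"
  proof (intro allI impI conjI ext)
    fix M N assume eq: "auction_equilibrium uA uB p q \<alpha> M N"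
    show "cdf M x = F_A3 uA uB q x" "cdf N x = F_B3 uA p q x" for x
      unfolding cdf_equilibrium_A[OF eq] cdf_equilibrium_B[OF eq] F_A3_def F_B3_def e by simp_all
    show "expected_payoff (payoffA uA p q \<alpha>) M N = 0"
      unfolding payoff_equilibrium_A[OF eq] by simp
    show "expected_payoff (payoffB uB p q \<alpha>) M N = ereal (uB - (uA + p) / q)"
      by (rule payoff_equilibrium_B[OF eq])
  qed
qed

end
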